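(* Let $n\ge 2$ and $m \ge 1$. Assume that the strictly positive and continuous function $\rho(\omega)$ on $S^{n-1}$ and the continuous functions $q_0, q_1, \ldots, q_{m-1}$ on $S^{n-1}$, not all (identically) zero, satisfy the infinitely many identities $$\sum_{j=0}^{m-1} c_{2k,j}\, \rho(\omega)^{2k-j} q_j(\omega) = p_{2k}(\omega) \in \mathcal{P}_{2k} \quad \text{for } k = 0,1,2,\ldots .$$ Then $\rho(\omega)^2$ is a (not identically vanishing) quadratic polynomial in $\omega$ (restricted to $S^{n-1}$).
   Context: $\mathcal{P}_k$ denotes the set of restrictions to the unit sphere $S^{n-1}\subset\mathbb{R}^n$ of homogeneous polynomials of degree $k$ in $\omega=(\omega_1,\ldots,\omega_n)$. The constants $c_{k,j}$ for non-negative integers $k,j$ are defined by $c_{0,0}=1$; $c_{k,j} = \frac{k!}{(k-j)!} = k(k-1)\cdots(k-j+1)$ if $0\le j\le k$ and $k \ge 1$; and $c_{k,j}=0$ if $j>k$. *)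

theory Defs
  imports "HOL-Analysis.Analysis"
begin

definition multi_indices :: "nat \<Rightarrow> ('n::finite \<Rightarrow> nat) set" where
  "multi_indices k = {\<alpha>. (\<Sum>i\<in>UNIV. \<alpha> i) = k}"

text \<open>The following guarantees that the sum in \<open>homogeneous_polynomial\<close> below is a genuine finite sum.\<close>

lemma finite_multi_indices [simp]: "finite (multi_indices k :: ('n::finite \<Rightarrow> nat) set)"
proof (rule finite_subset)
  show "multi_indices k \<subseteq> (UNIV :: 'n set) \<rightarrow>\<^sub>E {..k}"
    by (auto simp: multi_indices_def intro: member_le_sum)
qed (simp add: finite_PiE)

definition homogeneous_polynomial :: "nat \<Rightarrow> (real ^ 'n \<Rightarrow> real) \<Rightarrow> bool" where
  "homogeneous_polynomial k P \<longleftrightarrow>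
     (\<exists>a :: ('n \<Rightarrow> nat) \<Rightarrow> real.
        \<forall>x. P x = (\<Sum>\<alpha>\<in>multi_indices k. a \<alpha> * (\<Prod>i\<in>UNIV. (x $ i) ^ \<alpha> i)))"

text \<open>A function on the sphere is represented by any function on the ambient space with the
  given values on the sphere; values elsewhere are irrelevant. Zero is included for every \<open>k\<close>.\<close>

definition sphere_hom_polys :: "nat \<Rightarrow> (real ^ 'n \<Rightarrow> real) set" where
  "sphere_hom_polys k =
     {f. \<exists>P. homogeneous_polynomial k P \<and> (\<forall>\<omega>\<in>sphere 0 1. f \<omega> = P \<omega>)}"

definition c_coeff :: "nat \<Rightarrow> nat \<Rightarrow> real" where
  "c_coeff k j = (if j \<le> k then fact k / fact (k - j) else 0)"

end

theory Submission
  imports Defs "HOL-Computational_Algebra.Polynomial_Factorial"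
    "HOL-Computational_Algebra.Field_as_Ring"
begin

text \<open>
  Extend \<open>\<rho>\<^sup>2\<close> to a continuous function \<open>L\<close> on the whole space that is homogeneous of
  degree 2, and extend the given functions on the sphere to homogeneous polynomials \<open>P k\<close> of
  degree \<open>2 k\<close>. Since \<open>c_coeff (2 * k) j\<close> is a polynomial in \<open>k\<close> of degree \<open>j\<close>, the hypothesis
  says that \<open>P k x = L x ^ k * s\<^sub>x k\<close> away from the origin, where \<open>s\<^sub>x\<close> is a polynomial of degree at
  most \<open>E\<close> and \<open>E\<close> is the largest index for which \<open>q E\<close> is not identically zero.

  The dependence of \<open>s\<^sub>x\<close> on \<open>k\<close> is removed by a quadratic expression. For a fixed \<open>N\<close>, the
  polynomial \<open>i \<mapsto> s\<^sub>x i * s\<^sub>x (N - i)\<close> has degree at most \<open>2 E\<close>, and its coefficient in that degree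
  is, up to sign, the square of the coefficient of \<open>s\<^sub>x\<close> in degree \<open>E\<close>. This coefficient is a
  linear combination of the values at \<open>i = 0, ..., 2 E\<close>, with weights that depend on \<open>E\<close> only
  (\<open>top_coeff_square_from_values\<close>). So the same combination of the products
  \<open>P i * P (N - i)\<close> is \<open>L ^ N\<close> times a function that does not depend on \<open>N\<close>. After a shift of
  the index, which keeps \<open>N - i\<close> positive, this is a geometric family of polynomials
  \<open>W N = L ^ N * W 0\<close> in which \<open>W 0\<close> is not identically zero and the degree of \<open>W N\<close> is at most
  \<open>2 N\<close> plus a constant.

  On a line that is not contained in the zero set of \<open>W 0\<close> these are polynomials in one variable,
  and \<open>W 0 ^ N * W (Suc N) = W 1 ^ Suc N\<close> for all \<open>N\<close> forces \<open>W 0\<close> to divide \<open>W 1\<close>. Hence \<open>L\<close>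
  is a polynomial on the line, and comparison of degrees bounds its degree by 2
  (\<open>quadratic_of_geometric_polys\<close>). Lagrange interpolation at \<open>0, 1, -1\<close> turns this into an
  identity between values of \<open>L\<close>, which extends to all lines by density and continuity.
  Together with homogeneity the identity yields the parallelogram law and the linearity of the
  polar form, so \<open>L\<close> is a quadratic form (\<open>quadratic_form_of_quadratic_on_lines\<close>).
\<close>

section \<open>The leading coefficient as a combination of values\<close>

text \<open>The weights \<open>\<beta>\<close> are those of the \<open>D\<close>-th divided difference at the nodes \<open>0, ..., D\<close>. Only
  their independence of \<open>p\<close> matters, and synthetic division by the linear factor of the last
  node gives it by induction.\<close>

lemma top_coeff_from_values:
  "\<exists>\<beta>::nat \<Rightarrow> real. \<forall>p. degree p \<le> D \<longrightarrow> (\<Sum>i\<le>D. \<beta> i * poly p (real i)) = coeff p D"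
proof (induction D)
  case 0
  show ?case
    by (rule exI[of _ "\<lambda>_. 1"]) (auto elim!: degree_eq_zeroE)
next
  case (Suc D)
  then obtain \<beta> :: "nat \<Rightarrow> real"
    where \<beta>: "\<And>p. degree p \<le> D \<Longrightarrow> (\<Sum>i\<le>D. \<beta> i * poly p (real i)) = coeff p D"
    by blast
  define c where "c = real (Suc D)"
  define \<gamma> where "\<gamma> i = \<beta> i / (real i - c)" for i
  define \<delta> where "\<delta> i = (if i \<le> D then \<gamma> i else - (\<Sum>i\<le>D. \<gamma> i))" for i
  have "(\<Sum>i\<le>Suc D. \<delta> i * poly p (real i)) = coeff p (Suc D)" if deg: "degree p \<le> Suc D" for p
  proof -
    have "poly (p - [:poly p c:]) c = 0" by simp
    then obtain r where r: "p - [:poly p c:] = [:-c, 1:] * r"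
      by (metis dvdE poly_eq_0_iff_dvd)
    have p: "p = [:poly p c:] + [:-c, 1:] * r"
      using r by (simp add: algebra_simps)
    have degr: "degree r \<le> D"
    proof (cases "r = 0")
      case False
      have "degree (p - [:poly p c:]) \<le> Suc D"
        using deg by (intro degree_diff_le) auto
      moreover have "degree ([:-c, 1:] * r) = Suc (degree r)"
        using False by (subst degree_mult_eq) auto
      ultimately show ?thesis using r by simp
    qed simp
    have cf: "coeff p (Suc D) = coeff r D"
      using degr by (subst p) (simp add: coeff_eq_0)
    have val: "poly r (real i) = (poly p (real i) - poly p c) / (real i - c)" if "i \<le> D" for i
    proof -
      have "real i - c \<noteq> 0" using that by (simp add: c_def)
      moreover have "poly p (real i) - poly p c = (real i - c) * poly r (real i)"
        using arg_cong[OF r, of "\<lambda>f. poly f (real i)"] by (simp add: algebra_simps)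
      ultimately show ?thesis by simp
    qed
    have "(\<Sum>i\<le>Suc D. \<delta> i * poly p (real i))
        = (\<Sum>i\<le>D. \<gamma> i * poly p (real i)) - (\<Sum>i\<le>D. \<gamma> i) * poly p c"
      by (simp add: \<delta>_def c_def)
    also have "\<dots> = (\<Sum>i\<le>D. \<gamma> i * (poly p (real i) - poly p c))"
      by (simp add: right_diff_distrib sum_subtractf sum_distrib_right)
    also have "\<dots> = (\<Sum>i\<le>D. \<beta> i * poly r (real i))"
      by (intro sum.cong refl) (simp add: val \<gamma>_def)
    finally show ?thesis using \<beta>[OF degr] cf by simp
  qed
  then show ?case by (intro exI[of _ \<delta>] allI impI)
qed

lemma coeff_pcompose_linear:
  fixes p :: "real poly"
  assumes "degree p \<le> n" "b \<noteq> 0"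
  shows "coeff (p \<circ>\<^sub>p [:a, b:]) n = b ^ n * coeff p n"
proof (cases "degree p = n")
  case True
  have "lead_coeff (p \<circ>\<^sub>p [:a, b:]) = lead_coeff p * lead_coeff [:a, b:] ^ degree p"
    using assms by (intro lead_coeff_comp) auto
  then show ?thesis
    using True assms by (simp add: degree_pcompose)
next
  case False
  then show ?thesis
    using assms by (simp add: degree_pcompose coeff_eq_0)
qed

lemma coeff_mult_at_degree_bounds:
  fixes p r :: "real poly"
  assumes "degree p \<le> m" "degree r \<le> n"
  shows "coeff (p * r) (m + n) = coeff p m * coeff r n"
proof (cases "degree p = m \<and> degree r = n")
  case True
  then show ?thesis using coeff_mult_degree_sum[of p r] by simp
next
  case False
  then have "degree p < m \<or> degree r < n" using assms by auto
  moreover have "degree (p * r) < m + n"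
    using degree_mult_le[of p r] assms calculation by linarith
  ultimately show ?thesis by (auto simp: coeff_eq_0)
qed

text \<open>Applied to \<open>s\<close> with \<open>u k = l ^ k * s k\<close>, this says that a fixed combination of the products
  \<open>u i * u (N - i)\<close> is exactly geometric in \<open>N\<close>.\<close>

lemma top_coeff_square_from_values:
  "\<exists>\<beta>::nat \<Rightarrow> real. \<forall>p N. degree p \<le> E \<longrightarrow>
     (\<Sum>i\<le>2 * E. \<beta> i * poly p (real i) * poly p (N - real i)) = (coeff p E)\<^sup>2"
proof -
  obtain \<beta> :: "nat \<Rightarrow> real" where \<beta>:
    "\<And>p. degree p \<le> 2 * E \<Longrightarrow> (\<Sum>i\<le>2 * E. \<beta> i * poly p (real i)) = coeff p (2 * E)"
    using top_coeff_from_values by blast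
  have "(\<Sum>i\<le>2 * E. ((-1) ^ E * \<beta> i) * poly p (real i) * poly p (N - real i)) = (coeff p E)\<^sup>2"
    if deg: "degree p \<le> E" for p N
  proof -
    \<comment> \<open>the reflected polynomial \<open>i \<mapsto> p (N - i)\<close>\<close>
    define r where "r = p \<circ>\<^sub>p [:N, -1:]"
    have degr: "degree r \<le> E" using deg by (simp add: r_def degree_pcompose)
    have "degree (p * r) \<le> 2 * E" using degree_mult_le[of p r] deg degr by linarith
    then have "(\<Sum>i\<le>2 * E. \<beta> i * poly (p * r) (real i)) = coeff (p * r) (E + E)"
      using \<beta>[of "p * r"] by (simp only: mult_2)
    also have "\<dots> = coeff p E * coeff r E"
      using deg degr by (rule coeff_mult_at_degree_bounds)
    also have "coeff r E = (-1) ^ E * coeff p E"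
      unfolding r_def using deg by (intro coeff_pcompose_linear) auto
    finally have "(-1) ^ E * (\<Sum>i\<le>2 * E. \<beta> i * poly (p * r) (real i))
        = ((-1) ^ E * (-1) ^ E) * (coeff p E)\<^sup>2"
      by (simp only: power2_eq_square mult_ac)
    then show ?thesis
      by (simp add: r_def poly_pcompose sum_distrib_left mult_ac flip: power_mult_distrib)
  qed
  then show ?thesis by (intro exI[of _ "\<lambda>i. (-1) ^ E * \<beta> i"] allI impI)
qed

section \<open>The coefficients as polynomials in the index\<close>

text \<open>The falling factorial \<open>2 k (2 k - 1) ... (2 k - j + 1)\<close> as a polynomial in \<open>k\<close>. It vanishes
  for \<open>j > 2 k\<close>, so it agrees with \<open>c_coeff (2 * k) j\<close> for every \<open>k\<close>.\<close>

definition ffact_poly :: "nat \<Rightarrow> real poly" where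
  "ffact_poly j = (\<Prod>i<j. [:- real i, 2:])"

lemma poly_ffact_poly: "poly (ffact_poly j) (real k) = c_coeff (2 * k) j"
proof (induction j)
  case 0
  show ?case by (simp add: ffact_poly_def c_coeff_def)
next
  case (Suc j)
  have "poly (ffact_poly (Suc j)) (real k) = c_coeff (2 * k) j * (2 * real k - real j)"
    using Suc by (simp add: ffact_poly_def algebra_simps)
  also have "\<dots> = c_coeff (2 * k) (Suc j)"
  proof (cases "Suc j \<le> 2 * k")
    case True
    then obtain d where d: "2 * k = Suc j + d" using le_Suc_ex by blast
    have "2 * real k = real (Suc j + d)" using d by linarith
    then show ?thesis by (simp add: c_coeff_def d)
  next
    case False
    then have "j = 2 * k \<or> 2 * k < j" by auto
    then show ?thesis by (auto simp: c_coeff_def)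
  qed
  finally show ?case .
qed

lemma degree_ffact_poly: "degree (ffact_poly j) = j"
  by (simp add: ffact_poly_def degree_prod_sum_eq)

lemma coeff_ffact_poly: "coeff (ffact_poly j) j = 2 ^ j"
proof -
  have "lead_coeff (ffact_poly j) = 2 ^ j"
    unfolding ffact_poly_def by (simp add: lead_coeff_prod)
  then show ?thesis by (simp add: degree_ffact_poly)
qed

section \<open>Geometric families of polynomials in one variable\<close>

lemma continuous_zero_off_roots:
  fixes f :: "real \<Rightarrow> real"
  assumes "continuous_on UNIV f" "A \<noteq> 0" "\<And>t. poly A t \<noteq> 0 \<Longrightarrow> f t = 0"
  shows "f t = 0"
proof -
  obtain Z where Z: "finite Z" "\<And>s. s \<in> Z \<longleftrightarrow> poly A s = 0"
    using poly_roots_finite[OF assms(2)] by blast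
  have cl: "closure (- Z) = UNIV"
    by (simp only: closure_complement empty_interior_finite[OF Z(1)] Compl_empty_eq)
  show ?thesis
  proof (rule continuous_constant_on_closure[where f = f and S = "- Z"])
    show "continuous_on (closure (- Z)) f" unfolding cl by (rule assms(1))
    show "\<And>s. s \<in> - Z \<Longrightarrow> f s = 0" using assms(3) Z(2) by blast
    show "t \<in> closure (- Z)" unfolding cl by (rule UNIV_I)
  qed
qed

text \<open>After division by the greatest common divisor \<open>g\<close> every power of the reduced denominator
  divides \<open>g\<close>, so that the reduced denominator is constant.\<close>

lemma dvd_of_power_dvd:
  fixes A B :: "real poly"
  assumes "A \<noteq> 0" "\<And>N. A ^ N dvd B ^ Suc N"
  shows "A dvd B"
proof -
  define g where "g = gcd A B"
  have g0: "g \<noteq> 0" using assms(1) by (simp add: g_def)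
  obtain a b where ab: "A = a * g" "B = b * g" "coprime a b"
    using gcd_coprime_exists[of A B] g0 that unfolding g_def[symmetric] by metis
  have pw: "a ^ N dvd g" for N
  proof -
    have "a ^ N * g ^ N dvd (b ^ Suc N * g) * g ^ N"
      using assms(2)[of N] unfolding ab(1,2) power_mult_distrib power_Suc2[of g]
      by (simp only: mult.assoc mult.commute[of "g ^ N" g])
    then have "a ^ N dvd b ^ Suc N * g"
      using g0 by (simp only: dvd_mult_cancel_right power_eq_0_iff) auto
    moreover have "coprime (a ^ N) (b ^ Suc N)"
      using ab(3) by (simp only: coprime_power_left_iff coprime_power_right_iff) simp
    ultimately show ?thesis by (simp only: coprime_dvd_mult_right_iff)
  qed
  have a0: "a \<noteq> 0" using assms(1) unfolding ab(1) by simp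
  have "degree (a ^ Suc (degree g)) \<le> degree g"
    using pw g0 by (rule dvd_imp_degree_le)
  then have "Suc (degree g) * degree a \<le> degree g"
    using a0 by (simp add: degree_power_eq del: power_Suc)
  then have "degree a = 0"
    by (cases "degree a") auto
  then have "is_unit a" using a0 by (simp add: is_unit_iff_degree)
  then have "A dvd g" unfolding ab(1) by (simp only: mult_unit_dvd_iff') simp
  then show ?thesis unfolding ab(2) by (rule dvd_mult)
qed

lemma quadratic_of_geometric_polys:
  fixes l :: "real \<Rightarrow> real" and u :: "nat \<Rightarrow> real poly"
  assumes cont: "continuous_on UNIV l"
    and u: "\<And>N t. poly (u N) t = l t ^ N * poly (u 0) t"
    and deg: "\<And>N. degree (u N) \<le> d + 2 * N"
    and nz: "u 0 \<noteq> 0"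
  shows "\<exists>C. degree C \<le> 2 \<and> (\<forall>t. l t = poly C t)"
proof -
  have "u 0 ^ N * u (Suc N) = u (Suc 0) ^ Suc N" for N
    by (subst poly_eq_poly_eq_iff[symmetric], rule ext)
       (simp add: u[of "Suc N"] u[of "Suc 0"] power_mult_distrib mult_ac)
  then have "u 0 ^ N dvd u (Suc 0) ^ Suc N" for N by (metis dvd_triv_left)
  then have "u 0 dvd u (Suc 0)" using nz by (rule dvd_of_power_dvd[rotated])
  then obtain C where C: "u (Suc 0) = u 0 * C" by blast
  have l: "l t = poly C t" for t
  proof -
    have "l t - poly C t = 0"
    proof (rule continuous_zero_off_roots[OF _ nz, of "\<lambda>t. l t - poly C t"])
      show "continuous_on UNIV (\<lambda>t. l t - poly C t)"
        by (intro continuous_intros cont)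
      show "l t - poly C t = 0" if "poly (u 0) t \<noteq> 0" for t
        using u[of "Suc 0" t] that by (simp add: C)
    qed
    then show ?thesis by simp
  qed
  have "degree C \<le> 2"
  proof (rule ccontr)
    assume "\<not> degree C \<le> 2"
    then have C3: "degree C \<ge> 3" by simp
    then have C0: "C \<noteq> 0" by auto
    have "u (Suc d) = C ^ Suc d * u 0"
      by (subst poly_eq_poly_eq_iff[symmetric], rule ext) (simp add: u[of "Suc d"] l)
    then have "degree (u (Suc d)) = Suc d * degree C + degree (u 0)"
      using C0 nz by (simp add: degree_mult_eq degree_power_eq del: power_Suc)
    moreover have "Suc d * 3 \<le> Suc d * degree C" using C3 by (intro mult_le_mono2)
    ultimately show False using deg[of "Suc d"] by simp
  qed
  then show ?thesis using l by blast
qed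

section \<open>Homogeneous polynomials\<close>

lemma homogeneous_polynomial_on_line:
  assumes "homogeneous_polynomial k P"
  shows "\<exists>p. degree p \<le> k \<and> (\<forall>t. poly p t = P (x + t *\<^sub>R h))"
proof -
  obtain a where a: "\<And>x. P x = (\<Sum>\<alpha>\<in>multi_indices k. a \<alpha> * (\<Prod>i\<in>UNIV. (x $ i) ^ \<alpha> i))"
    using assms unfolding homogeneous_polynomial_def by blast
  define p where
    "p = (\<Sum>\<alpha>\<in>multi_indices k. smult (a \<alpha>) (\<Prod>i\<in>UNIV. [:x $ i, h $ i:] ^ \<alpha> i))"
  have "degree p \<le> k"
    unfolding p_def
  proof (intro degree_sum_le finite_multi_indices)
    fix \<alpha> :: "'a \<Rightarrow> nat" assume \<alpha>: "\<alpha> \<in> multi_indices k"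
    have "degree (smult (a \<alpha>) (\<Prod>i\<in>UNIV. [:x $ i, h $ i:] ^ \<alpha> i))
        \<le> degree (\<Prod>i\<in>UNIV. [:x $ i, h $ i:] ^ \<alpha> i)"
      by (rule degree_smult_le)
    also have "\<dots> \<le> (\<Sum>i\<in>UNIV. degree ([:x $ i, h $ i:] ^ \<alpha> i))"
      using degree_prod_sum_le[of UNIV "\<lambda>i. [:x $ i, h $ i:] ^ \<alpha> i"] by (simp add: o_def)
    also have "\<dots> \<le> (\<Sum>i\<in>UNIV. \<alpha> i)"
    proof (rule sum_mono)
      fix i
      have "degree ([:x $ i, h $ i:] ^ \<alpha> i) \<le> degree [:x $ i, h $ i:] * \<alpha> i"
        by (rule degree_power_le)
      also have "\<dots> \<le> 1 * \<alpha> i"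
        by (rule mult_right_mono) auto
      finally show "degree ([:x $ i, h $ i:] ^ \<alpha> i) \<le> \<alpha> i" by simp
    qed
    also have "\<dots> = k" using \<alpha> by (simp add: multi_indices_def)
    finally show "degree (smult (a \<alpha>) (\<Prod>i\<in>UNIV. [:x $ i, h $ i:] ^ \<alpha> i)) \<le> k" .
  qed
  moreover have "poly p t = P (x + t *\<^sub>R h)" for t
    by (simp add: p_def a poly_sum poly_prod)
  ultimately show ?thesis by blast
qed

lemma homogeneous_polynomial_scaleR:
  assumes "homogeneous_polynomial k P"
  shows "P (c *\<^sub>R x) = c ^ k * P x"
proof -
  obtain a where a: "\<And>x. P x = (\<Sum>\<alpha>\<in>multi_indices k. a \<alpha> * (\<Prod>i\<in>UNIV. (x $ i) ^ \<alpha> i))"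
    using assms unfolding homogeneous_polynomial_def by blast
  have "(\<Prod>i\<in>UNIV. ((c *\<^sub>R x) $ i) ^ \<alpha> i) = c ^ k * (\<Prod>i\<in>UNIV. (x $ i) ^ \<alpha> i)"
    if "\<alpha> \<in> multi_indices k" for \<alpha>
    using that by (simp add: multi_indices_def power_mult_distrib prod.distrib flip: power_sum)
  then show ?thesis
    by (simp add: a sum_distrib_left mult_ac)
qed

lemma homogeneous_polynomial_sum:
  assumes "finite I" "\<And>i. i \<in> I \<Longrightarrow> homogeneous_polynomial k (f i)"
  shows "homogeneous_polynomial k (\<lambda>x. \<Sum>i\<in>I. b i * f i x)"
proof -
  have "\<forall>i\<in>I. \<exists>a. \<forall>x. f i x = (\<Sum>\<alpha>\<in>multi_indices k. a \<alpha> * (\<Prod>i\<in>UNIV. (x $ i) ^ \<alpha> i))"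
    using assms(2) unfolding homogeneous_polynomial_def by blast
  then obtain a where a: "\<And>i x. i \<in> I \<Longrightarrow>
      f i x = (\<Sum>\<alpha>\<in>multi_indices k. a i \<alpha> * (\<Prod>i\<in>UNIV. (x $ i) ^ \<alpha> i))"
    by metis
  have "(\<Sum>i\<in>I. b i * f i x)
      = (\<Sum>\<alpha>\<in>multi_indices k. (\<Sum>i\<in>I. b i * a i \<alpha>) * (\<Prod>i\<in>UNIV. (x $ i) ^ \<alpha> i))" for x
  proof -
    have "(\<Sum>i\<in>I. b i * f i x)
        = (\<Sum>i\<in>I. \<Sum>\<alpha>\<in>multi_indices k. b i * a i \<alpha> * (\<Prod>i\<in>UNIV. (x $ i) ^ \<alpha> i))"
      by (intro sum.cong refl) (simp add: a sum_distrib_left mult.assoc)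
    also have "\<dots> = (\<Sum>\<alpha>\<in>multi_indices k. \<Sum>i\<in>I. b i * a i \<alpha> * (\<Prod>i\<in>UNIV. (x $ i) ^ \<alpha> i))"
      by (rule sum.swap)
    finally show ?thesis by (simp add: sum_distrib_right)
  qed
  then show ?thesis
    unfolding homogeneous_polynomial_def
    by (intro exI[of _ "\<lambda>\<alpha>. \<Sum>i\<in>I. b i * a i \<alpha>"]) blast
qed

lemma homogeneous_polynomial_coordinate_product:
  "homogeneous_polynomial 2 (\<lambda>x::real ^ 'n. x $ i * x $ j)"
proof -
  define \<beta> :: "'n \<Rightarrow> nat" where "\<beta> l = (if l = i then 1 else 0) + (if l = j then 1 else 0)" for l
  have \<beta>: "\<beta> \<in> multi_indices 2"
    by (simp add: multi_indices_def \<beta>_def sum.distrib)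
  have "x $ i * x $ j = (\<Sum>\<alpha>\<in>multi_indices 2. (if \<alpha> = \<beta> then 1 else 0) * (\<Prod>l\<in>UNIV. (x $ l) ^ \<alpha> l))"
    for x :: "real ^ 'n"
  proof -
    have "(\<Sum>\<alpha>\<in>multi_indices 2. (if \<alpha> = \<beta> then 1 else 0) * (\<Prod>l\<in>UNIV. (x $ l) ^ \<alpha> l))
        = (\<Sum>\<alpha>\<in>multi_indices 2. if \<alpha> = \<beta> then \<Prod>l\<in>UNIV. (x $ l) ^ \<beta> l else 0)"
      by (intro sum.cong) auto
    also have "\<dots> = (\<Prod>l\<in>UNIV. (x $ l) ^ \<beta> l)"
      using \<beta> by simp
    also have "\<dots> = (\<Prod>l\<in>UNIV. (if l = i then x $ l else 1) * (if l = j then x $ l else 1))"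
      by (intro prod.cong) (auto simp: \<beta>_def)
    also have "\<dots> = x $ i * x $ j"
      by (simp add: prod.distrib)
    finally show ?thesis by simp
  qed
  then show ?thesis
    unfolding homogeneous_polynomial_def
    by (intro exI[of _ "\<lambda>\<alpha>. if \<alpha> = \<beta> then 1 else 0"] allI)
qed

section \<open>Quadratic forms from quadratic behaviour on lines\<close>

text \<open>The hypothesis \<open>line\<close> is the Lagrange interpolation formula with nodes \<open>0, 1, -1\<close>: it says that
  \<open>L\<close> is a polynomial of degree at most 2 on every line.\<close>

lemma quadratic_form_of_quadratic_on_lines:
  fixes L :: "real ^ 'n \<Rightarrow> real"
  assumes cont: "continuous_on UNIV L"
    and scale: "\<And>t x. t \<ge> 0 \<Longrightarrow> L (t *\<^sub>R x) = t\<^sup>2 * L x"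
    and line: "\<And>x h t. L (x + t *\<^sub>R h)
        = (1 - t\<^sup>2) * L x + (t\<^sup>2 + t) / 2 * L (x + h) + (t\<^sup>2 - t) / 2 * L (x - h)"
  shows "homogeneous_polynomial 2 L"
proof -
  \<comment> \<open>By homogeneity, comparing the growth in \<open>t\<close> of both sides of \<open>line\<close> amounts to letting
      \<open>s = 1 / t\<close> tend to 0.\<close>
  have parallelogram: "L (x + h) + L (x - h) = 2 * L x + 2 * L h" for x h
  proof -
    have eq: "L (s *\<^sub>R x + h) = (s\<^sup>2 - 1) * L x + (1 + s) / 2 * L (x + h) + (1 - s) / 2 * L (x - h)"
      if s: "s > 0" for s
    proof -
      have "s *\<^sub>R x + h = s *\<^sub>R (x + (1 / s) *\<^sub>R h)" using s by (simp add: scaleR_add_right)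
      then have "L (s *\<^sub>R x + h) = s\<^sup>2 * L (x + (1 / s) *\<^sub>R h)" using s by (simp add: scale)
      also have "\<dots> = s\<^sup>2 * ((1 - (1/s)\<^sup>2) * L x + ((1/s)\<^sup>2 + 1/s) / 2 * L (x + h)
          + ((1/s)\<^sup>2 - 1/s) / 2 * L (x - h))" by (simp only: line)
      also have "\<dots> = (s\<^sup>2 - 1) * L x + (1 + s) / 2 * L (x + h) + (1 - s) / 2 * L (x - h)"
        using s by (simp add: field_simps power2_eq_square)
      finally show ?thesis .
    qed
    define z where "z = (\<lambda>n. 1 / real (Suc n))"
    have z: "z \<longlonglongrightarrow> 0" unfolding z_def by (rule LIMSEQ_Suc[OF lim_1_over_n])
    have "isCont L h" using cont by (simp add: continuous_on_eq_continuous_at)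
    moreover have "(\<lambda>n. z n *\<^sub>R x + h) \<longlonglongrightarrow> 0 *\<^sub>R x + h"
      by (intro tendsto_intros z)
    ultimately have "(\<lambda>n. L (z n *\<^sub>R x + h)) \<longlonglongrightarrow> L h"
      using isCont_tendsto_compose[of h L "\<lambda>n. z n *\<^sub>R x + h"] by simp
    moreover have "(\<lambda>n. L (z n *\<^sub>R x + h))
        \<longlonglongrightarrow> (0\<^sup>2 - 1) * L x + (1 + 0) / 2 * L (x + h) + (1 - 0) / 2 * L (x - h)"
    proof -
      have "L (z n *\<^sub>R x + h)
          = ((z n)\<^sup>2 - 1) * L x + (1 + z n) / 2 * L (x + h) + (1 - z n) / 2 * L (x - h)" for n
        by (rule eq) (simp add: z_def)
      then show ?thesis by (simp only:) (intro tendsto_intros z, simp_all)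
    qed
    ultimately have "L h = (0\<^sup>2 - 1) * L x + (1 + 0) / 2 * L (x + h) + (1 - 0) / 2 * L (x - h)"
      by (rule LIMSEQ_unique)
    then show ?thesis by (simp add: field_simps)
  qed
  have L0: "L 0 = 0" using scale[of 0 0] by simp
  have even: "L (- h) = L h" for h
    using parallelogram[of 0 h] L0 by simp
  \<comment> \<open>4 times the symmetric bilinear form of \<open>L\<close>, that is \<open>B x x = 4 * L x\<close>\<close>
  define B where "B x h = L (x + h) - L (x - h)" for x h
  have sym: "B x h = B h x" for x h
    using even[of "x - h"] by (simp add: B_def add.commute)
  have B_scale: "B x (t *\<^sub>R h) = t * B x h" for x t h
    using line[of x t h] line[of x "- t" h] by (simp add: B_def field_simps)
  have B_add: "B x (u + v) = B x u + B x v" for x u v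
  proof -
    define h g where "h = (1/2) *\<^sub>R (u + v)" and "g = (1/2) *\<^sub>R (u - v)"
    have uv: "u = h + g" "v = h - g"
      by (simp_all add: h_def g_def vec_eq_iff field_simps)
    have "B x u + B x v = (L ((x + h) + g) + L ((x + h) - g)) - (L ((x - h) + g) + L ((x - h) - g))"
      by (simp add: B_def uv algebra_simps)
    also have "\<dots> = 2 * B x h"
      by (simp only: parallelogram) (simp add: B_def)
    also have "\<dots> = B x (u + v)"
      using B_scale[of x "1/2" "u + v"] by (simp add: h_def)
    finally show ?thesis by simp
  qed
  have lin: "linear (B x)" for x
    by (rule linearI) (simp_all add: B_add B_scale)
  have expand: "B y x = (\<Sum>i\<in>UNIV. x $ i * B y (axis i 1))" for x y
  proof -
    have "B y x = B y (\<Sum>i\<in>UNIV. x $ i *\<^sub>R axis i 1)"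
      using basis_expansion[of x] by (simp add: scalar_mult_eq_scaleR)
    then show ?thesis by (simp add: linear_sum[OF lin] B_scale)
  qed
  have "L x = (\<Sum>i\<in>UNIV. 1 * (\<Sum>j\<in>UNIV. (B (axis i 1) (axis j 1) / 4) * (x $ i * x $ j)))" for x
  proof -
    have "4 * L x = B x x"
      using scale[of 2 x] L0 by (simp add: B_def scaleR_2)
    also have "\<dots> = (\<Sum>i\<in>UNIV. x $ i * B (axis i 1) x)"
      by (subst expand) (intro sum.cong refl arg_cong2[where f = "(*)"] sym)
    also have "\<dots> = (\<Sum>i\<in>UNIV. \<Sum>j\<in>UNIV. B (axis i 1) (axis j 1) * (x $ i * x $ j))"
      by (intro sum.cong refl, subst expand) (simp add: sum_distrib_left mult_ac)
    finally show ?thesis by (simp add: field_simps flip: sum_divide_distrib)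
  qed
  then have "L = (\<lambda>x. \<Sum>i\<in>UNIV. 1 * (\<Sum>j\<in>UNIV. (B (axis i 1) (axis j 1) / 4) * (x $ i * x $ j)))"
    by blast
  moreover have "homogeneous_polynomial 2 \<dots>"
    by (intro homogeneous_polynomial_sum homogeneous_polynomial_coordinate_product) auto
  ultimately show ?thesis by simp
qed

section \<open>Geometric families of polynomials in several variables\<close>

lemma continuous_on_homogeneous_extension:
  fixes \<rho> :: "'a::euclidean_space \<Rightarrow> real"
  assumes "continuous_on (sphere 0 1) \<rho>"
  shows "continuous_on UNIV (\<lambda>x. (norm x)\<^sup>2 * (\<rho> (sgn x))\<^sup>2)" (is "continuous_on _ ?L")
proof -
  have "isCont ?L x" for x
  proof (cases "x = 0")
    case False
    have "continuous_on (- {0}) ?L"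
      by (intro continuous_intros continuous_on_compose2[OF assms]) (auto simp: norm_sgn split: if_splits)
    then show ?thesis
      using False by (simp add: continuous_on_eq_continuous_at open_Compl)
  next
    case True
    have "bounded (\<rho> ` sphere 0 1)"
      by (intro compact_imp_bounded compact_continuous_image assms compact_sphere)
    then obtain B where B: "\<And>w. w \<in> sphere 0 1 \<Longrightarrow> \<bar>\<rho> w\<bar> \<le> B"
      unfolding bounded_iff ball_simps(9) real_norm_def by blast
    have bound: "norm (?L y) \<le> (norm y)\<^sup>2 * B\<^sup>2" for y
    proof (cases "y = 0")
      case False
      then have "\<bar>\<rho> (sgn y)\<bar> \<le> B" by (intro B) (simp add: norm_sgn)
      then have "(\<rho> (sgn y))\<^sup>2 \<le> B\<^sup>2" by (rule abs_le_square_iff[THEN iffD1, OF order_trans]) simp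
      then show ?thesis by (simp add: mult_left_mono)
    qed simp
    have "((\<lambda>y::'a. (norm y)\<^sup>2 * B\<^sup>2) \<longlongrightarrow> (norm (0::'a))\<^sup>2 * B\<^sup>2) (at 0)"
      by (intro tendsto_intros)
    then have "((\<lambda>y::'a. (norm y)\<^sup>2 * B\<^sup>2) \<longlongrightarrow> 0) (at 0)" by simp
    then have "(?L \<longlongrightarrow> 0) (at 0)"
      by (rule Lim_null_comparison[rotated]) (intro always_eventually allI bound)
    then show ?thesis using True by (simp add: isCont_def)
  qed
  then show ?thesis by (simp add: continuous_on_eq_continuous_at)
qed

lemma quadratic_form_of_geometric_family:
  fixes L :: "real ^ 'n \<Rightarrow> real" and W :: "nat \<Rightarrow> real ^ 'n \<Rightarrow> real"
  assumes cont: "continuous_on UNIV L"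
    and scale: "\<And>t x. t \<ge> 0 \<Longrightarrow> L (t *\<^sub>R x) = t\<^sup>2 * L x"
    and W: "\<And>N x. W N x = L x ^ N * W 0 x"
    and poly_W: "\<And>N x h. \<exists>p. degree p \<le> d + 2 * N \<and> (\<forall>t. poly p t = W N (x + t *\<^sub>R h))"
    and nz: "W 0 y \<noteq> 0"
  shows "homogeneous_polynomial 2 L"
proof (rule quadratic_form_of_quadratic_on_lines[OF cont scale])
  fix x h :: "real ^ 'n" and t :: real
  define F where "F z = L (z + t *\<^sub>R h) - ((1 - t\<^sup>2) * L z + (t\<^sup>2 + t) / 2 * L (z + h)
      + (t\<^sup>2 - t) / 2 * L (z - h))" for z
  have contL: "continuous_on UNIV (\<lambda>e. L (g e))" if "continuous_on UNIV g" for g :: "real \<Rightarrow> _"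
    using continuous_on_compose2[OF cont that] by simp
  have generic: "F z = 0" if z: "W 0 z \<noteq> 0" for z
  proof -
    obtain u where u: "\<And>N. degree (u N) \<le> d + 2 * N" "\<And>N t. poly (u N) t = W N (z + t *\<^sub>R h)"
      using poly_W[of _ z h] by metis
    have "poly (u 0) 0 \<noteq> 0" using z by (simp add: u(2))
    then have u0: "u 0 \<noteq> 0" by auto
    have "\<exists>C. degree C \<le> 2 \<and> (\<forall>t. L (z + t *\<^sub>R h) = poly C t)"
    proof (rule quadratic_of_geometric_polys[OF _ _ u(1) u0])
      show "continuous_on UNIV (\<lambda>t. L (z + t *\<^sub>R h))"
        by (intro contL continuous_intros)
      show "poly (u N) t = L (z + t *\<^sub>R h) ^ N * poly (u 0) t" for N t
        unfolding u(2) by (rule W)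
    qed
    then obtain C where C: "degree C \<le> 2" "\<And>t. L (z + t *\<^sub>R h) = poly C t" by blast
    have Ct: "poly C t = coeff C 0 + coeff C 1 * t + coeff C 2 * t\<^sup>2" for t
    proof -
      have "poly C t = (\<Sum>i\<le>2. coeff C i * t ^ i)"
        unfolding poly_altdef using C(1)
        by (intro sum.mono_neutral_left) (auto simp: coeff_eq_0)
      then show ?thesis by (simp add: numeral_2_eq_2)
    qed
    have "L z = coeff C 0" "L (z + h) = coeff C 0 + coeff C 1 + coeff C 2"
      "L (z - h) = coeff C 0 - coeff C 1 + coeff C 2"
      using C(2)[of 0] C(2)[of 1] C(2)[of "-1"] by (simp_all add: Ct)
    then show ?thesis
      unfolding F_def C(2) Ct by (simp only:) (simp add: field_simps)
  qed
  \<comment> \<open>On the line through \<open>x\<close> and \<open>y\<close> only finitely many points are not generic, so \<open>x\<close> is a limit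
      of generic points.\<close>
  obtain A where A: "\<And>e. poly A e = W 0 (x + e *\<^sub>R (y - x))"
    using poly_W[of 0 x "y - x"] by blast
  have "poly A 1 \<noteq> 0" using nz by (simp add: A)
  then have A0: "A \<noteq> 0" by auto
  have "F (x + 0 *\<^sub>R (y - x)) = 0"
  proof (rule continuous_zero_off_roots[OF _ A0, of "\<lambda>e. F (x + e *\<^sub>R (y - x))"])
    show "continuous_on UNIV (\<lambda>e. F (x + e *\<^sub>R (y - x)))"
      unfolding F_def by (intro continuous_intros contL) auto
    show "F (x + e *\<^sub>R (y - x)) = 0" if "poly A e \<noteq> 0" for e
      using that by (intro generic) (simp add: A)
  qed
  then show "L (x + t *\<^sub>R h) = (1 - t\<^sup>2) * L x + (t\<^sup>2 + t) / 2 * L (x + h) + (t\<^sup>2 - t) / 2 * L (x - h)"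
    by (simp add: F_def)
qed

section \<open>The square of the radius function is a quadratic form\<close>

theorem theorem2:
  fixes \<rho> :: "real ^ 'n \<Rightarrow> real"
    and q :: "nat \<Rightarrow> real ^ 'n \<Rightarrow> real"
    and m :: nat
  assumes "CARD('n) \<ge> 2" and "m \<ge> 1"
    and "continuous_on (sphere 0 1) \<rho>"
    and "\<And>\<omega>. \<omega> \<in> sphere 0 1 \<Longrightarrow> \<rho> \<omega> > 0"
    and "\<And>j. j < m \<Longrightarrow> continuous_on (sphere 0 1) (q j)"
    and "\<exists>j<m. \<exists>\<omega>\<in>sphere 0 1. q j \<omega> \<noteq> 0"
    and "\<And>k::nat. (\<lambda>\<omega>. \<Sum>j<m. c_coeff (2 * k) j * \<rho> \<omega> powi (2 * int k - int j) * q j \<omega>)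
                    \<in> sphere_hom_polys (2 * k)"
  shows "(\<lambda>\<omega>. (\<rho> \<omega>)\<^sup>2) \<in> sphere_hom_polys 2 \<and> (\<exists>\<omega>\<in>sphere 0 1. (\<rho> \<omega>)\<^sup>2 \<noteq> 0)"
proof -
  note cont = assms(3) and pos = assms(4)
  define L where "L x = (norm x)\<^sup>2 * (\<rho> (sgn x))\<^sup>2" for x
  have L_sphere: "L w = (\<rho> w)\<^sup>2" if "w \<in> sphere 0 1" for w
    using that by (simp add: L_def sgn_div_norm)
  obtain P where P_hom: "\<And>k. homogeneous_polynomial (2 * k) (P k)"
    and P_sphere: "\<And>k w. w \<in> sphere 0 1 \<Longrightarrow>
      P k w = (\<Sum>j<m. c_coeff (2 * k) j * \<rho> w powi (2 * int k - int j) * q j w)"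
    using assms(7) unfolding sphere_hom_polys_def mem_Collect_eq by metis
  define J where "J = {j. j < m \<and> (\<exists>w\<in>sphere 0 1. q j w \<noteq> 0)}"
  have J: "finite J" "J \<noteq> {}" using assms(6) by (auto simp: J_def)
  define E where "E = Max J"
  have "E \<in> J" unfolding E_def using J by (rule Max_in)
  then obtain w0 where Em: "E < m" and w0: "w0 \<in> sphere 0 1" "q E w0 \<noteq> 0"
    by (auto simp: J_def)
  have q_above: "q j w = 0" if "E < j" "j < m" "w \<in> sphere 0 1" for j w
  proof (rule ccontr)
    assume "q j w \<noteq> 0"
    then have "j \<in> J" using that by (auto simp: J_def)
    then have "j \<le> E" unfolding E_def using J(1) by simp
    then show False using that(1) by simp
  qed
  \<comment> \<open>the polynomial in \<open>k\<close> that remains of the given sum after division by \<open>L x ^ k\<close>\<close>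
  define s where "s x = (\<Sum>j\<le>E. smult (q j (sgn x) / \<rho> (sgn x) ^ j) (ffact_poly j))" for x
  have deg_s: "degree (s x) \<le> E" for x
    unfolding s_def
    by (intro degree_sum_le finite_atMost)
       (auto intro: order_trans[OF degree_smult_le] simp: degree_ffact_poly)
  have top_s: "coeff (s x) E = q E (sgn x) / \<rho> (sgn x) ^ E * 2 ^ E" for x
  proof -
    have "coeff (s x) E = (\<Sum>j\<le>E. if j = E then q j (sgn x) / \<rho> (sgn x) ^ j * 2 ^ j else 0)"
      unfolding s_def coeff_sum
      by (intro sum.cong refl) (auto simp: coeff_ffact_poly coeff_eq_0 degree_ffact_poly)
    then show ?thesis by simp
  qed
  have P_eq: "P k x = L x ^ k * poly (s x) (real k)" if x: "x \<noteq> 0" for k x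
  proof -
    let ?w = "sgn x"
    have w: "?w \<in> sphere 0 1" using x by (simp add: norm_sgn)
    have r: "\<rho> ?w \<noteq> 0" using pos[OF w] by simp
    have "P k ?w = (\<Sum>j<m. c_coeff (2 * k) j * \<rho> ?w powi (2 * int k - int j) * q j ?w)"
      by (rule P_sphere[OF w])
    also have "\<dots> = (\<Sum>j\<le>E. c_coeff (2 * k) j * \<rho> ?w powi (2 * int k - int j) * q j ?w)"
      using Em w by (intro sum.mono_neutral_right) (auto simp: q_above not_le)
    also have "\<dots> = (\<Sum>j\<le>E. \<rho> ?w ^ (2 * k) * (q j ?w / \<rho> ?w ^ j * c_coeff (2 * k) j))"
    proof (rule sum.cong[OF refl])
      fix j
      have "\<rho> ?w powi (2 * int k - int j) = \<rho> ?w ^ (2 * k) / \<rho> ?w ^ j"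
        using r power_int_diff[of "\<rho> ?w" "int (2 * k)" "int j"] by (simp add: power_int_of_nat del: of_nat_mult) simp
      then show "c_coeff (2 * k) j * \<rho> ?w powi (2 * int k - int j) * q j ?w
          = \<rho> ?w ^ (2 * k) * (q j ?w / \<rho> ?w ^ j * c_coeff (2 * k) j)"
        by simp
    qed
    also have "\<dots> = \<rho> ?w ^ (2 * k) * poly (s x) (real k)"
      by (simp add: s_def poly_sum poly_ffact_poly sum_distrib_left)
    finally have Pw: "P k ?w = \<rho> ?w ^ (2 * k) * poly (s x) (real k)" .
    have "x = norm x *\<^sub>R ?w" using x by (simp add: sgn_div_norm)
    then have "P k x = norm x ^ (2 * k) * P k ?w"
      using homogeneous_polynomial_scaleR[OF P_hom] by metis
    then show ?thesis
      by (simp add: Pw L_def power_mult power_mult_distrib)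
  qed
  have P_zero: "P k 0 = 0" if "k > 0" for k
    using homogeneous_polynomial_scaleR[OF P_hom, of k 0 0] that by (simp add: power_0_left)
  obtain \<beta> :: "nat \<Rightarrow> real" where \<beta>: "\<And>p N. degree p \<le> E \<Longrightarrow>
      (\<Sum>i\<le>2 * E. \<beta> i * poly p (real i) * poly p (N - real i)) = (coeff p E)\<^sup>2"
    using top_coeff_square_from_values by blast
  \<comment> \<open>\<open>2 * E\<close> would be enough away from the origin. The additional 1 makes the index \<open>M + N - i\<close>
      positive, so that every \<open>W N\<close> vanishes at the origin.\<close>
  define M where "M = 2 * E + 1"
  define W where "W N x = (\<Sum>i\<le>2 * E. \<beta> i * P i x * P (M + N - i) x)" for N x
  have W_eq: "W N x = L x ^ (M + N) * (coeff (s x) E)\<^sup>2" if x: "x \<noteq> 0" for N x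
  proof -
    have "W N x = (\<Sum>i\<le>2 * E. L x ^ (M + N) *
        (\<beta> i * poly (s x) (real i) * poly (s x) (real (M + N) - real i)))"
      unfolding W_def
    proof (rule sum.cong[OF refl])
      fix i assume "i \<in> {..2 * E}"
      then have i: "i \<le> M + N" by (simp add: M_def)
      then have "L x ^ (M + N) = L x ^ i * L x ^ (M + N - i)" by (simp flip: power_add)
      then show "\<beta> i * P i x * P (M + N - i) x = L x ^ (M + N) *
        (\<beta> i * poly (s x) (real i) * poly (s x) (real (M + N) - real i))"
        using i by (simp only: P_eq[OF x] of_nat_diff mult_ac)
    qed
    also have "\<dots> = L x ^ (M + N) * (coeff (s x) E)\<^sup>2"
      by (simp only: \<beta>[OF deg_s] flip: sum_distrib_left)
    finally show ?thesis .
  qed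
  have W_geometric: "W N x = L x ^ N * W 0 x" for N x
  proof (cases "x = 0")
    case True
    have "W N 0 = 0" for N
      unfolding W_def by (intro sum.neutral ballI) (simp add: P_zero M_def)
    then show ?thesis using True by simp
  next
    case False
    then show ?thesis by (simp add: W_eq power_add)
  qed
  have W_line: "\<exists>p. degree p \<le> 2 * M + 2 * N \<and> (\<forall>t. poly p t = W N (x + t *\<^sub>R h))" for N x h
  proof -
    obtain u where u: "\<And>k. degree (u k) \<le> 2 * k" "\<And>k t. poly (u k) t = P k (x + t *\<^sub>R h)"
      using homogeneous_polynomial_on_line[OF P_hom, of _ x h] by metis
    define p where "p = (\<Sum>i\<le>2 * E. smult (\<beta> i) (u i * u (M + N - i)))"
    have "degree p \<le> 2 * M + 2 * N"
      unfolding p_def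
    proof (intro degree_sum_le finite_atMost)
      fix i assume i: "i \<in> {..2 * E}"
      have "degree (smult (\<beta> i) (u i * u (M + N - i))) \<le> degree (u i) + degree (u (M + N - i))"
        by (rule order_trans[OF degree_smult_le degree_mult_le])
      also have "\<dots> \<le> 2 * i + 2 * (M + N - i)" by (intro add_mono u)
      also have "\<dots> = 2 * M + 2 * N" using i by (simp add: M_def)
      finally show "degree (smult (\<beta> i) (u i * u (M + N - i))) \<le> 2 * M + 2 * N" .
    qed
    moreover have "poly p t = W N (x + t *\<^sub>R h)" for t
      by (simp add: p_def W_def poly_sum u(2) mult.assoc)
    ultimately show ?thesis by blast
  qed
  have "homogeneous_polynomial 2 L"
  proof (rule quadratic_form_of_geometric_family[where W = W and y = w0 and d = "2 * M"])
    show "continuous_on UNIV L"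
      unfolding L_def using cont by (rule continuous_on_homogeneous_extension)
    show "L (t *\<^sub>R x) = t\<^sup>2 * L x" if "t \<ge> 0" for t x
      using that by (cases "t = 0") (simp_all add: L_def sgn_scaleR power_mult_distrib)
    have "w0 \<noteq> 0" "sgn w0 = w0" using w0(1) by (auto simp: sgn_div_norm)
    then show "W 0 w0 \<noteq> 0"
      using w0 pos[OF w0(1)] by (simp add: W_eq top_s L_sphere)
  qed (rule W_geometric W_line)+
  then have "(\<lambda>w. (\<rho> w)\<^sup>2) \<in> sphere_hom_polys 2"
    unfolding sphere_hom_polys_def using L_sphere by fastforce
  moreover have "(\<rho> w0)\<^sup>2 \<noteq> 0" using pos[OF w0(1)] by simp
  ultimately show ?thesis using w0(1) by blast
qed

end
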